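(* Let $N\ge2$ be an integer, let $\varepsilon\ne0$ be real, let $\|\cdot\|$ be any norm on $\mathbb{R}^N$, and let $\omega(\tau_\sigma)=\|\bm{D}(\tau_\sigma)\bm{\delta}_\sigma\|$ for $\tau_\sigma\in[-1,1]\setminus\mathcal{T}_N$, with $\bm{D}(\tau_\sigma)$, $\bm{\delta}_\sigma$ and $\mathcal{T}_N$ as defined in the context. If $\tau_\sigma$ is a global minimizer of $\omega$ over $[-1,1]\setminus\mathcal{T}_N$, then the choice $\tau_\sigma$ mitigates the Runge phenomenon associated with the Lagrange interpolating polynomial $l_\sigma$ of index $\sigma$, i.e. $$|l_\sigma(\tau)|\le l_\sigma(\tau_\sigma)=1\qquad\text{for all }\tau\in[-1,1].$$
   Context: $\mathcal{P}_n$ is the Legendre polynomial of degree $n$, and the Lobatto polynomial of degree $N\ge2$ is $\mathcal{L}_N(\tau)=(\tau^2-1)\dot{\mathcal{P}}_{N-1}(\tau)$ (a dot denotes $d/d\tau$). $\mathcal{T}_N=\{\tau_1,\dots,\tau_N\}\subset[-1,1]$ is the set of its $N$ distinct roots. Put $\sigma=N+1$, and let $\tau_\sigma=\tau_{N+1}\in[-1,1]\setminus\mathcal{T}_N$ be an additional abscissa (the exceptional sample). For $i\in\{1,\dots,N+1\}$ the Lagrange interpolating polynomials are $$l_i(\tau)=\prod_{j\in\{1,\dots,N+1\}\setminus\{i\}}\frac{\tau-\tau_j}{\tau_i-\tau_j}.$$ $\bm{D}(\tau_\sigma)\in\mathbb{R}^{N\times(N+1)}$ is the matrix with entries $\bm{D}_{ki}=\dot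 l_i(\tau_k)$, $k\in\{1,\dots,N\}$, $i\in\{1,\dots,N+1\}$. $\bm{\delta}_\sigma\in\mathbb{R}^{N+1}$ is the vector whose entries are all zero except the entry with index $\sigma$, which equals $\varepsilon$. The Runge phenomenon associated with $l_\sigma$ is said to be mitigated if $|l_\sigma(\tau)|\le l_\sigma(\tau_\sigma)=1$ for all $\tau\in[-1,1]$ (so that $l_\sigma$ remains bounded for arbitrary $N$). *)

theory Defs
  imports "HOL-Computational_Algebra.Polynomial" "Jordan_Normal_Form.Matrix"
begin

text \<open>Rodrigues' formula.\<close>
definition legendre :: "nat \<Rightarrow> real poly" where
  "legendre n = Polynomial.smult (1 / (2 ^ n * fact n)) ((pderiv ^^ n) ([:-1, 0, 1:] ^ n))"

definition lobatto :: "nat \<Rightarrow> real poly" where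
  "lobatto N = [:-1, 0, 1:] * pderiv (legendre (N - 1))"

definition lobatto_nodes :: "nat \<Rightarrow> real set" where
  "lobatto_nodes N = {t. poly (lobatto N) t = 0}"

definition lagrange :: "nat \<Rightarrow> (nat \<Rightarrow> real) \<Rightarrow> nat \<Rightarrow> real poly" where
  "lagrange n x i = (\<Prod>j\<in>{1..n} - {i}. Polynomial.smult (1 / (x i - x j)) [:- x j, 1:])"

text \<open>
  Abscissas are numbered from 1: \<open>\<tau> 1, \<dots>, \<tau> N\<close> are the Lobatto nodes, and the exceptional
  sample \<open>s\<close> takes the index \<open>\<sigma> = N + 1\<close>. Matrix and vector entries are numbered from 0, whence
  the shifts below.
\<close>
definition exc_lagrange :: "nat \<Rightarrow> (nat \<Rightarrow> real) \<Rightarrow> real \<Rightarrow> nat \<Rightarrow> real poly" where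
  "exc_lagrange N \<tau> s i = lagrange (N + 1) (\<tau>(N + 1 := s)) i"

definition diff_mat :: "nat \<Rightarrow> (nat \<Rightarrow> real) \<Rightarrow> real \<Rightarrow> real mat" where
  "diff_mat N \<tau> s =
     mat N (N + 1) (\<lambda>(k, i). poly (pderiv (exc_lagrange N \<tau> s (i + 1))) (\<tau> (k + 1)))"

definition delta_vec :: "nat \<Rightarrow> real \<Rightarrow> real vec" where
  "delta_vec N \<epsilon> = vec (N + 1) (\<lambda>i. if i + 1 = N + 1 then \<epsilon> else 0)"

definition is_norm :: "nat \<Rightarrow> (real vec \<Rightarrow> real) \<Rightarrow> bool" where
  "is_norm n \<nu> \<longleftrightarrow>
     (\<forall>v\<in>carrier_vec n. 0 \<le> \<nu> v \<and> (\<nu> v = 0 \<longleftrightarrow> v = 0\<^sub>v n)) \<and>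
     (\<forall>c. \<forall>v\<in>carrier_vec n. \<nu> (c \<cdot>\<^sub>v v) = \<bar>c\<bar> * \<nu> v) \<and>
     (\<forall>v\<in>carrier_vec n. \<forall>w\<in>carrier_vec n. \<nu> (v + w) \<le> \<nu> v + \<nu> w)"

definition omega :: "(real vec \<Rightarrow> real) \<Rightarrow> nat \<Rightarrow> (nat \<Rightarrow> real) \<Rightarrow> real \<Rightarrow> real \<Rightarrow> real" where
  "omega \<nu> N \<tau> \<epsilon> s = \<nu> (diff_mat N \<tau> s *\<^sub>v delta_vec N \<epsilon>)"

definition runge_mitigated :: "real poly \<Rightarrow> real \<Rightarrow> bool" where
  "runge_mitigated l s \<longleftrightarrow> (\<forall>t\<in>{-1..1}. \<bar>poly l t\<bar> \<le> poly l s) \<and> poly l s = 1"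

text \<open>
  The Lobatto polynomial of degree \<open>N \<ge> 2\<close> has exactly \<open>N\<close> distinct real roots, all in
  \<open>[-1, 1]\<close>, so that they can be enumerated as \<open>\<tau> 1, \<dots>, \<tau> N\<close>.
\<close>

lemma poly_rolle_roots:
  fixes p :: "real poly"
  assumes "finite S" "card S = Suc m" "S \<subseteq> {a..b}" "\<forall>x\<in>S. poly p x = 0"
  shows "\<exists>T. finite T \<and> card T = m \<and> T \<subseteq> {a<..<b} \<and> (\<forall>x\<in>T. poly (pderiv p) x = 0)"
  using assms
proof (induction m arbitrary: S b)
  case 0
  then show ?case by (intro exI[of _ "{}"]) auto
next
  case (Suc m)
  define M where "M = Max S"
  define S' where "S' = S - {M}"
  have ne: "S \<noteq> {}" using Suc.prems by auto
  have M: "M \<in> S" unfolding M_def using ne Suc.prems by (intro Max_in) auto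
  have f': "finite S'" and c': "card S' = Suc m"
    using Suc.prems M by (auto simp: S'_def)
  have ne': "S' \<noteq> {}" using c' by auto
  define b' where "b' = Max S'"
  have b': "b' \<in> S'" unfolding b'_def using ne' f' by (intro Max_in) auto
  have le: "b' < M"
    using b' Max_ge[OF Suc.prems(1), of b'] by (auto simp: S'_def M_def)
  have sub: "S' \<subseteq> {a..b'}"
  proof
    fix x assume x: "x \<in> S'"
    then have "x \<in> {a..b}" using Suc.prems(3) by (auto simp: S'_def)
    then show "x \<in> {a..b'}" using Max_ge[OF f' x] by (simp add: b'_def)
  qed
  obtain T where T: "finite T" "card T = m" "T \<subseteq> {a<..<b'}"
      "\<forall>x\<in>T. poly (pderiv p) x = 0"
    using Suc.IH[OF f' c' sub] Suc.prems(4) by (auto simp: S'_def)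
  have z0: "poly p b' = 0" "poly p M = 0"
    using Suc.prems(4) b' M by (auto simp: S'_def)
  obtain z where z: "b' < z" "z < M" "poly (pderiv p) z = 0"
    using poly_MVT[OF le, of p] z0 le by auto
  have "a \<le> b'" "M \<le> b" using b' M Suc.prems(3) by (auto simp: S'_def)
  moreover have "z \<notin> T" using T z by force
  ultimately show ?case
    using T z le by (intro exI[of _ "insert z T"]) (auto simp: subset_iff)
qed

lemma power_dvd_pderiv:
  fixes p q :: "real poly"
  assumes "q ^ Suc k dvd p"
  shows "q ^ k dvd pderiv p"
proof -
  obtain r where "p = q ^ Suc k * r" using assms by (elim dvdE)
  then have "pderiv p = q ^ k * (q * pderiv r + r * Polynomial.smult (of_nat (Suc k)) (pderiv q))"
    by (simp only: pderiv_mult pderiv_power_Suc) (simp add: algebra_simps)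
  then show ?thesis by simp
qed

lemma power_dvd_pderiv_funpow:
  fixes q :: "real poly"
  assumes "j \<le> n"
  shows "q ^ (n - j) dvd (pderiv ^^ j) (q ^ n)"
  using assms
proof (induction j)
  case (Suc j)
  then have "q ^ Suc (n - Suc j) dvd (pderiv ^^ j) (q ^ n)"
    by (simp add: Suc_diff_Suc del: power_Suc)
  then show ?case using power_dvd_pderiv by simp
qed simp

lemma rodrigues_roots:
  assumes "j \<le> n"
  shows "\<exists>S. finite S \<and> card S = j \<and> S \<subseteq> {-1<..<1} \<and>
           (\<forall>x\<in>S. poly ((pderiv ^^ j) ([:-1, 0, 1:] ^ n)) x = (0::real))"
  using assms
proof (induction j)
  case 0
  then show ?case by (intro exI[of _ "{}"]) auto
next
  case (Suc j)
  let ?f = "(pderiv ^^ j) ([:-1, 0, 1:] ^ n) :: real poly"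
  obtain S where S: "finite S" "card S = j" "S \<subseteq> {-1<..<1}" "\<forall>x\<in>S. poly ?f x = 0"
    using Suc by auto
  have "[:-1, 0, 1:] ^ Suc (n - Suc j) dvd ?f"
    using power_dvd_pderiv_funpow[of j n "[:-1, 0, 1:]"] Suc.prems
    by (simp add: Suc_diff_Suc del: power_Suc)
  then have "[:-1, 0, 1:] dvd ?f" by (metis dvd_mult_left power_Suc)
  then have "poly ?f 1 = 0" "poly ?f (-1) = 0" by (auto elim!: dvdE)
  moreover have "card (insert (-1) (insert 1 S)) = Suc (Suc j)"
    using S by (subst card_insert_disjoint; force)+
  ultimately show ?case
    using poly_rolle_roots[of "insert (-1) (insert 1 S)" "Suc j" "-1" 1 ?f] S by force
qed

lemma degree_pderiv_funpow:
  "degree ((pderiv ^^ j) (p :: real poly)) = degree p - j"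
  by (induction j) (auto simp: degree_pderiv)

lemma degree_legendre: "degree (legendre n) = n"
  by (simp add: legendre_def degree_pderiv_funpow degree_power_eq)

lemma lobatto_nodes_card:
  assumes "N \<ge> 2"
  shows "finite (lobatto_nodes N)" "card (lobatto_nodes N) = N" "lobatto_nodes N \<subseteq> {-1..1}"
proof -
  define n where "n = N - 1"
  have n: "n \<ge> 1" "N = Suc n" using assms by (auto simp: n_def)
  have nz: "pderiv (legendre n) \<noteq> 0"
    using n degree_legendre[of n] by (simp add: pderiv_eq_0_iff)
  have lz: "lobatto N \<noteq> 0" using nz by (simp add: lobatto_def n del: mult_pCons_left)
  have deg: "degree (lobatto N) = N"
    using degree_mult_eq[OF _ nz, of "[:-1, 0, 1:]"] n
    by (simp add: lobatto_def degree_pderiv degree_legendre del: mult_pCons_left)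
  obtain S where S: "finite S" "card S = n" "S \<subseteq> {-1<..<1}" "\<forall>x\<in>S. poly (legendre n) x = 0"
    using rodrigues_roots[of n n] by (auto simp: legendre_def)
  obtain T where T: "finite T" "card T = n - 1" "T \<subseteq> {-1<..<1}"
      "\<forall>x\<in>T. poly (pderiv (legendre n)) x = 0"
    using poly_rolle_roots[of S "n - 1" "-1" 1 "legendre n"] S n by force
  define R where "R = insert (-1) (insert 1 T)"
  have cR: "card R = N"
    unfolding R_def using T n by (subst card_insert_disjoint; force)+
  show fin: "finite (lobatto_nodes N)"
    unfolding lobatto_nodes_def using lz by (rule poly_roots_finite)
  have sub: "R \<subseteq> lobatto_nodes N"
    using T by (auto simp: R_def lobatto_nodes_def lobatto_def n simp del: mult_pCons_left)
  have "card (lobatto_nodes N) \<le> N"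
    using card_poly_roots_bound[OF lz] deg by (simp add: lobatto_nodes_def)
  then have eq: "R = lobatto_nodes N"
    using card_subset_eq[OF fin sub] card_mono[OF fin sub] cR by simp
  show "card (lobatto_nodes N) = N" using eq cR by simp
  show "lobatto_nodes N \<subseteq> {-1..1}" using T by (auto simp: R_def simp flip: eq)
qed

lemma lobatto_nodes_enumeration:
  assumes "N \<ge> 2"
  shows "\<exists>\<tau>. bij_betw \<tau> {1..N} (lobatto_nodes N)"
  using ex_bij_betw_nat_finite_1 lobatto_nodes_card[OF assms] by metis

end

theory Submission
  imports Defs
begin

text \<open>
  Let \<open>W\<close> be the monic polynomial whose roots are the nodes \<open>\<tau> 1, \<dots>, \<tau> N\<close> (up to a constant,
  the Lobatto polynomial). The exceptional sample \<open>s\<close> enters \<open>l\<^sub>\<sigma>\<close> only through a normalizing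
  factor: \<open>l\<^sub>\<sigma> = W / W(s)\<close> (\<open>exc_lagrange_last\<close>). Hence \<open>\<^bold>D(s) \<^bold>\<delta>\<^sub>\<sigma>\<close>, which is \<open>\<epsilon>\<close> times the
  last column of \<open>\<^bold>D(s)\<close>, is \<open>\<epsilon> / W(s)\<close> times the fixed vector of the values \<open>W'(\<tau> k)\<close>, and
  \<open>\<omega>(s) = C / \<bar>W(s)\<bar>\<close> for a constant \<open>C\<close>, whatever the norm (\<open>omega_eq\<close>). As the nodes are
  distinct, they are simple roots of \<open>W\<close>, so that the fixed vector is nonzero and \<open>C > 0\<close>.
  Minimizing \<open>\<omega>\<close> therefore means maximizing \<open>\<bar>W\<bar>\<close> over the non-nodes of \<open>[-1, 1]\<close>, and even over
  all of \<open>[-1, 1]\<close>, since \<open>W\<close> vanishes at the nodes. At a maximizer \<open>s\<close>,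
  \<open>\<bar>l\<^sub>\<sigma>(t)\<bar> = \<bar>W(t)\<bar> / \<bar>W(s)\<bar> \<le> 1\<close>.
\<close>

definition node_poly :: "nat \<Rightarrow> (nat \<Rightarrow> real) \<Rightarrow> real poly" where
  "node_poly N \<tau> = (\<Prod>j\<in>{1..N}. [:- \<tau> j, 1:])"

definition node_slopes :: "nat \<Rightarrow> (nat \<Rightarrow> real) \<Rightarrow> real vec" where
  "node_slopes N \<tau> = vec N (\<lambda>k. poly (pderiv (node_poly N \<tau>)) (\<tau> (k + 1)))"

lemma node_poly_eq_0_iff: "poly (node_poly N \<tau>) t = 0 \<longleftrightarrow> t \<in> \<tau> ` {1..N}"
  by (auto simp: node_poly_def poly_prod)

lemma exc_lagrange_last:
  "exc_lagrange N \<tau> s (N + 1) =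
     Polynomial.smult (1 / poly (node_poly N \<tau>) s) (node_poly N \<tau>)"
proof -
  have "{1..N + 1} - {N + 1} = {1..N}" by auto
  then have "exc_lagrange N \<tau> s (N + 1) =
      (\<Prod>j\<in>{1..N}. Polynomial.smult (1 / (s - \<tau> j)) [:- \<tau> j, 1:])"
    unfolding exc_lagrange_def lagrange_def by (auto intro!: prod.cong)
  also have "\<dots> = Polynomial.smult (\<Prod>j\<in>{1..N}. 1 / (s - \<tau> j)) (node_poly N \<tau>)"
    unfolding node_poly_def by (rule prod_smult)
  also have "(\<Prod>j\<in>{1..N}. 1 / (s - \<tau> j)) = 1 / poly (node_poly N \<tau>) s"
    by (simp add: node_poly_def poly_prod prod_dividef)
  finally show ?thesis .
qed

lemma diff_mat_mult_delta_vec: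
  "diff_mat N \<tau> s *\<^sub>v delta_vec N \<epsilon> = (\<epsilon> / poly (node_poly N \<tau>) s) \<cdot>\<^sub>v node_slopes N \<tau>"
proof (rule eq_vecI)
  fix k assume "k < dim_vec ((\<epsilon> / poly (node_poly N \<tau>) s) \<cdot>\<^sub>v node_slopes N \<tau>)"
  then have k: "k < N" by (simp add: node_slopes_def)
  have "(diff_mat N \<tau> s *\<^sub>v delta_vec N \<epsilon>) $ k =
      (\<Sum>i\<in>{0..<N + 1}. poly (pderiv (exc_lagrange N \<tau> s (i + 1))) (\<tau> (k + 1)) *
                       (if i = N then \<epsilon> else 0))"
    using k by (simp add: diff_mat_def delta_vec_def scalar_prod_def)
  also have "\<dots> = (\<Sum>i\<in>{0..<N + 1}. if i = N
      then poly (pderiv (exc_lagrange N \<tau> s (i + 1))) (\<tau> (k + 1)) * \<epsilon> else 0)"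
    by (rule sum.cong) auto
  also have "\<dots> = poly (pderiv (exc_lagrange N \<tau> s (N + 1))) (\<tau> (k + 1)) * \<epsilon>"
    by (subst sum.delta) auto
  finally show "(diff_mat N \<tau> s *\<^sub>v delta_vec N \<epsilon>) $ k =
      ((\<epsilon> / poly (node_poly N \<tau>) s) \<cdot>\<^sub>v node_slopes N \<tau>) $ k"
    using k by (simp add: exc_lagrange_last pderiv_smult node_slopes_def del: One_nat_def)
qed (simp add: diff_mat_def node_slopes_def)

text \<open>
  At the simple root \<open>\<tau> 1\<close>, the derivative of the node polynomial equals the product of the
  factors belonging to the other nodes, so that already the first entry is nonzero.
\<close>
lemma node_slopes_nonzero:
  assumes "inj_on \<tau> {1..N}" "N \<ge> 1"
  shows "node_slopes N \<tau> \<noteq> 0\<^sub>v N"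
proof
  assume eq: "node_slopes N \<tau> = 0\<^sub>v N"
  define V where "V = (\<Prod>j\<in>{1..N} - {1}. [:- \<tau> j, 1:])"
  have "node_poly N \<tau> = [:- \<tau> 1, 1:] * V"
    unfolding node_poly_def V_def using assms(2) by (intro prod.remove) auto
  then have "poly (pderiv (node_poly N \<tau>)) (\<tau> 1) = poly V (\<tau> 1)"
    by (simp add: pderiv_mult pderiv_pCons del: mult_pCons_left)
  moreover have "\<tau> 1 \<noteq> \<tau> j" if "j \<in> {1..N} - {1}" for j
    using inj_onD[OF assms(1), of 1 j] that by auto
  then have "poly V (\<tau> 1) \<noteq> 0"
    unfolding V_def poly_prod by (subst prod_zero_iff) auto
  moreover have "node_slopes N \<tau> $ 0 = poly (pderiv (node_poly N \<tau>)) (\<tau> 1)"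
    using assms(2) by (simp add: node_slopes_def)
  ultimately show False using eq assms(2) by simp
qed

lemma omega_eq:
  assumes "is_norm N \<nu>"
  shows "omega \<nu> N \<tau> \<epsilon> s = \<bar>\<epsilon>\<bar> * \<nu> (node_slopes N \<tau>) / \<bar>poly (node_poly N \<tau>) s\<bar>"
proof -
  have "node_slopes N \<tau> \<in> carrier_vec N" by (simp add: node_slopes_def)
  then show ?thesis
    using assms by (simp add: omega_def diff_mat_mult_delta_vec is_norm_def)
qed

theorem proposition1:
  fixes N :: nat and \<epsilon> :: real and \<nu> :: "real vec \<Rightarrow> real"
    and \<tau> :: "nat \<Rightarrow> real" and s :: real
  assumes "N \<ge> 2"
    and "\<epsilon> \<noteq> 0"
    and "is_norm N \<nu>"
    and "bij_betw \<tau> {1..N} (lobatto_nodes N)"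
    and "is_arg_min (omega \<nu> N \<tau> \<epsilon>) (\<lambda>x. x \<in> {-1..1} - lobatto_nodes N) s"
  shows "runge_mitigated (exc_lagrange N \<tau> s (N + 1)) s"
proof -
  define w where "w t = poly (node_poly N \<tau>) t" for t
  define C where "C = \<bar>\<epsilon>\<bar> * \<nu> (node_slopes N \<tau>)"
  have inj: "inj_on \<tau> {1..N}" and img: "\<tau> ` {1..N} = lobatto_nodes N"
    using assms(4) by (auto simp: bij_betw_def)
  have w0: "w t = 0 \<longleftrightarrow> t \<in> lobatto_nodes N" for t
    by (simp only: w_def node_poly_eq_0_iff img)
  have min: "omega \<nu> N \<tau> \<epsilon> s \<le> omega \<nu> N \<tau> \<epsilon> t" if "t \<in> {-1..1} - lobatto_nodes N" for t
    using assms(5) that by (auto simp: is_arg_min_linorder)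
  have om: "omega \<nu> N \<tau> \<epsilon> t = C / \<bar>w t\<bar>" for t
    using omega_eq[OF assms(3)] by (simp add: C_def w_def)
  have ws: "w s \<noteq> 0" using assms(5) w0 by (auto simp: is_arg_min_def)
  have "node_slopes N \<tau> \<in> carrier_vec N" by (simp add: node_slopes_def)
  then have "\<nu> (node_slopes N \<tau>) \<ge> 0"
    and "\<nu> (node_slopes N \<tau>) = 0 \<longleftrightarrow> node_slopes N \<tau> = 0\<^sub>v N"
    using assms(3) by (simp_all add: is_norm_def)
  then have "\<nu> (node_slopes N \<tau>) > 0"
    using node_slopes_nonzero[OF inj] assms(1) by simp
  then have C: "C > 0" using assms(2) by (simp add: C_def)
  have max: "\<bar>w t\<bar> \<le> \<bar>w s\<bar>" if "t \<in> {-1..1}" for t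
  proof (cases "t \<in> lobatto_nodes N")
    case True
    then have "w t = 0" using w0 by simp
    then show ?thesis by simp
  next
    case False
    then have "C / \<bar>w s\<bar> \<le> C / \<bar>w t\<bar>" using min that by (simp add: om)
    moreover have "w t \<noteq> 0" using False w0 by simp
    ultimately show ?thesis using C ws by (simp add: field_simps)
  qed
  have "poly (exc_lagrange N \<tau> s (N + 1)) t = w t / w s" for t
    by (simp only: exc_lagrange_last w_def poly_smult) simp
  then show ?thesis
    using max ws by (simp add: runge_mitigated_def)
qed

end
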